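(* Let $s\in\mathbb C$ with $\operatorname{Re}(s)>1$. Then $$\frac{1}{\prod_{p\in\mathbb P}\left(1-\frac1{p^s}\right)}=\sum_{n=1}^\infty\frac1{n^s}=\zeta(s),$$ and moreover $$\zeta(s)=1+\sum_{p\in\mathbb P}\frac{1}{p^s\prod_{r\in\mathbb P,\ r\le p}\left(1-\frac1{r^s}\right)}.$$
   Context: $\mathbb P$ denotes the set of prime numbers and $\zeta$ the Riemann zeta function. *)

theory Defs
  imports "HOL-Complex_Analysis.Complex_Analysis" "HOL-Computational_Algebra.Primes"
    "HOL-Library.Infinite_Set"
begin

text \<open>
  The Riemann zeta function: the analytic continuation of the Dirichlet series
  \<open>1 + 1 / 2\<^sup>s + 1 / 3\<^sup>s + \<dots>\<close> from the half-plane \<open>Re z > 1\<close>. Its value at \<open>s\<close> is the common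
  value at \<open>s\<close> of all holomorphic extensions of the series to a domain \<open>U\<close> that contains both
  the half-plane and \<open>s\<close>. By the identity theorem and the existence of the continuation to
  \<open>- {1}\<close>, this determines the usual value for every \<open>s \<noteq> 1\<close>; at the pole \<open>s = 1\<close>
  there is no such extension and the value is unspecified.
\<close>

definition riemann_zeta :: "complex \<Rightarrow> complex" where
  "riemann_zeta s = (THE w. \<exists>U f.
     open U \<and> connected U \<and> {z. Re z > 1} \<subseteq> U \<and> s \<in> U \<and>
     f holomorphic_on U \<and>
     (\<forall>z. Re z > 1 \<longrightarrow> (\<lambda>n. 1 / of_nat (Suc n) powr z) sums f z) \<and>
     f s = w)"

text \<open>
  The library's infinite products are indexed by \<open>nat\<close>, so a product over all primes is taken
  along their increasing enumeration \<open>2, 3, 5, \<dots>\<close> (indices start at 0). The theorem states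
  absolute convergence, which makes the value independent of the order of the factors.
\<close>

definition nth_prime :: "nat \<Rightarrow> nat" where
  "nth_prime k = enumerate {p. prime p} k"

end

theory Submission
  imports Defs
begin

text \<open>
  Sieving out the first \<open>N\<close> primes multiplies \<open>\<zeta>(s)\<close> by \<open>P\<^sub>N = (\<Prod>k<N. 1 - p\<^sub>k\<^sup>-\<^sup>s)\<close> and leaves the
  sum over the integers without prime factor among them, that is, \<open>1\<close> plus a tail that tends
  to \<open>0\<close>. Hence \<open>P\<^sub>N \<zeta>(s) \<longlonglongrightarrow> 1\<close>, which is the product formula. As
  \<open>p\<^sub>k\<^sup>-\<^sup>s / P\<^sub>k\<^sub>+\<^sub>1 = 1 / P\<^sub>k\<^sub>+\<^sub>1 - 1 / P\<^sub>k\<close>, the second series telescopes.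
\<close>

section \<open>The increasing enumeration of the primes\<close>

lemma bij_betw_nth_prime: "bij_betw nth_prime UNIV {p. prime p}"
  unfolding nth_prime_def using bij_enumerate[OF primes_infinite] .

lemma prime_nth_prime [simp]: "prime (nth_prime k)"
  using bij_betw_nth_prime by (auto simp: bij_betw_def)

lemma strict_mono_nth_prime: "strict_mono nth_prime"
  unfolding nth_prime_def using strict_mono_enumerate[OF primes_infinite] .

lemma le_nth_prime: "k \<le> nth_prime k"
  unfolding nth_prime_def using le_enumerate[OF primes_infinite] .

lemma primes_le_nth_prime: "{r. prime r \<and> r \<le> nth_prime k} = nth_prime ` {..k}"
proof -
  have "prime r \<longleftrightarrow> r \<in> range nth_prime" for r
    using bij_betw_nth_prime by (auto simp: bij_betw_def)
  then show ?thesis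
    by (auto simp: strict_mono_less_eq[OF strict_mono_nth_prime])
qed

section \<open>Sieving sums by the first \<open>N\<close> primes\<close>

definition rough :: "nat \<Rightarrow> nat set" where
  "rough N = {n. n > 0 \<and> (\<forall>k<N. \<not> nth_prime k dvd n)}"

lemma rough_0: "rough 0 = {0<..}"
  by (auto simp: rough_def)

text \<open>If the prime with index \<open>N\<close> divides \<open>n\<close>, the cofactor inherits
  the avoidance of the earlier primes. Conversely, multiplying by this prime introduces none of
  them, since distinct primes do not divide each other.\<close>

lemma rough_Suc: "rough N = rough (Suc N) \<union> (*) (nth_prime N) ` rough N"
proof (intro equalityI subsetI)
  fix n assume n: "n \<in> rough N"
  show "n \<in> rough (Suc N) \<union> (*) (nth_prime N) ` rough N"
  proof (cases "nth_prime N dvd n")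
    case True
    then obtain m where "n = nth_prime N * m" by blast
    with n have "m \<in> rough N" by (auto simp: rough_def)
    with \<open>n = _\<close> show ?thesis by blast
  next
    case False
    with n show ?thesis by (auto simp: rough_def less_Suc_eq)
  qed
next
  fix n assume "n \<in> rough (Suc N) \<union> (*) (nth_prime N) ` rough N"
  moreover have "\<not> nth_prime k dvd nth_prime N" if "k < N" for k
    using strict_monoD[OF strict_mono_nth_prime that] primes_dvd_imp_eq[of "nth_prime k" "nth_prime N"]
    by auto
  ultimately show "n \<in> rough N"
    by (auto simp: rough_def prime_dvd_mult_iff prime_gt_0_nat)
qed

lemma rough_Suc_disjoint: "rough (Suc N) \<inter> (*) (nth_prime N) ` rough N = {}"
  by (auto simp: rough_def)

lemma one_in_rough: "1 \<in> rough N"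
proof -
  have "nth_prime k \<noteq> 1" for k by (metis not_prime_1 prime_nth_prime)
  then show ?thesis by (auto simp: rough_def)
qed

text \<open>Any prime factor of such an \<open>n\<close> has some index \<open>k \<ge> N\<close>,
  and the prime with index \<open>k\<close> is at least \<open>k\<close>. This crude bound is enough
  to compare with the tail of a series.\<close>

lemma rough_diff_1: "rough N - {1} \<subseteq> {N..}"
proof
  fix n assume n: "n \<in> rough N - {1}"
  then obtain p where p: "prime p" "p dvd n" using prime_factor_nat[of n] by auto
  then obtain k where k: "p = nth_prime k"
    using bij_betw_nth_prime by (auto simp: bij_betw_def)
  have "N \<le> k" using n p k by (auto simp: rough_def not_less[symmetric])
  also have "k \<le> p" using le_nth_prime k by simp
  also have "p \<le> n" using p n by (auto simp: rough_def intro: dvd_imp_le)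
  finally show "n \<in> {N..}" by simp
qed

text \<open>By complete multiplicativity the part of the sum removed in step \<open>N\<close> is
  \<open>f ?p\<close> times the whole sum over \<open>rough N\<close>, so each step contributes a
  factor \<open>1 - f ?p\<close>.\<close>

lemma infsum_rough:
  fixes f :: "nat \<Rightarrow> complex"
  assumes mult: "\<And>m n. f (m * n) = f m * f n"
    and summable: "summable (\<lambda>n. norm (f n))"
  shows "infsum f (rough N) = (\<Prod>k<N. 1 - f (nth_prime k)) * infsum f {0<..}"
proof (induction N)
  case 0
  show ?case by (simp add: rough_0)
next
  case (Suc N)
  let ?p = "nth_prime N"
  have on: "f summable_on A" for A
    using norm_summable_imp_summable_on[OF summable] summable_on_subset_banach by blast
  have inj: "inj_on ((*) ?p) (rough N)"
    using prime_gt_0_nat[OF prime_nth_prime, of N] by (auto simp: inj_on_def)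
  have "infsum f (rough N) = infsum f (rough (Suc N)) + infsum f ((*) ?p ` rough N)"
    by (subst rough_Suc) (rule infsum_Un_disjoint[OF on on rough_Suc_disjoint])
  also have "infsum f ((*) ?p ` rough N) = f ?p * infsum f (rough N)"
    unfolding infsum_reindex[OF inj] o_def mult by (rule infsum_cmult_right')
  finally have "infsum f (rough (Suc N)) = infsum f (rough N) - f ?p * infsum f (rough N)"
    unfolding eq_diff_eq by (rule sym)
  then show ?case using Suc.IH by (simp add: algebra_simps)
qed

text \<open>Apart from \<open>1\<close>, only indices from \<open>N\<close> on survive, so the error
  is at most a tail of the convergent series of norms.\<close>

lemma infsum_rough_tendsto:
  fixes f :: "nat \<Rightarrow> complex"
  assumes summable: "summable (\<lambda>n. norm (f n))"
  shows "(\<lambda>N. infsum f (rough N)) \<longlonglongrightarrow> f 1"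
proof -
  have on: "f summable_on A" for A
    using norm_summable_imp_summable_on[OF summable] summable_on_subset_banach by blast
  have abs_on: "(\<lambda>n. norm (f n)) summable_on A" for A
    using summable_nonneg_imp_summable_on[OF summable] summable_on_subset_banach by auto
  have bound: "norm (infsum f (rough N) - f 1) \<le> (\<Sum>n. norm (f (n + N)))" for N
  proof -
    have "infsum f (rough N) = infsum f ({1} \<union> (rough N - {1}))"
      using one_in_rough by (simp add: insert_absorb)
    also have "\<dots> = f 1 + infsum f (rough N - {1})"
      by (subst infsum_Un_disjoint) (auto intro: on)
    finally have "norm (infsum f (rough N) - f 1) = norm (infsum f (rough N - {1}))"
      by simp
    also have "\<dots> \<le> (\<Sum>\<^sub>\<infinity>n\<in>rough N - {1}. norm (f n))"
      by (rule norm_infsum_bound[OF abs_on])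
    also have "\<dots> \<le> (\<Sum>\<^sub>\<infinity>n\<in>{N..}. norm (f n))"
      by (rule infsum_mono2[OF abs_on abs_on rough_diff_1]) simp
    also have "\<dots> = (\<Sum>\<^sub>\<infinity>n. norm (f (n + N)))"
      by (rule infsum_reindex_bij_witness[where j = "\<lambda>n. n - N" and i = "\<lambda>n. n + N"]) auto
    also have "\<dots> = (\<Sum>n. norm (f (n + N)))"
      by (rule infsumI, rule norm_summable_imp_has_sum)
        (auto intro: summable_ignore_initial_segment[OF summable])
    finally show ?thesis .
  qed
  have "(\<lambda>N. infsum f (rough N) - f 1) \<longlonglongrightarrow> 0"
    using bound
    by (intro Lim_null_comparison[OF always_eventually suminf_exist_split2[OF summable]]) blast
  then show ?thesis by (rule LIM_zero_cancel)
qed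

lemma partial_euler_product_tendsto:
  fixes f :: "nat \<Rightarrow> complex"
  assumes "\<And>m n. f (m * n) = f m * f n" and "f 1 = 1" and summable: "summable (\<lambda>n. norm (f n))"
  shows "(\<lambda>N. (\<Prod>k<N. 1 - f (nth_prime k)) * (\<Sum>n. f (Suc n))) \<longlonglongrightarrow> 1"
proof -
  have "infsum f {0<..} = (\<Sum>\<^sub>\<infinity>n. f (Suc n))"
    by (rule infsum_reindex_bij_witness[where j = "\<lambda>n. n - 1" and i = Suc]) auto
  also have "\<dots> = (\<Sum>n. f (Suc n))"
  proof (rule infsumI, rule norm_summable_imp_has_sum)
    show "summable (\<lambda>n. norm (f (Suc n)))"
      using summable by (subst summable_Suc_iff)
    then show "(\<lambda>n. f (Suc n)) sums (\<Sum>n. f (Suc n))"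
      by (rule summable_sums[OF summable_norm_cancel])
  qed
  finally show ?thesis
    using infsum_rough_tendsto[OF summable] infsum_rough[of f, OF assms(1) summable] assms(2) by simp
qed

lemma sum_div_partial_prods:
  fixes a :: "nat \<Rightarrow> 'a::field"
  assumes "\<And>k. a k \<noteq> 1"
  shows "(\<Sum>k<N. a k / (\<Prod>j\<le>k. 1 - a j)) = 1 / (\<Prod>k<N. 1 - a k) - 1"
proof (induction N)
  case (Suc N)
  \<comment> \<open>If \<open>Q = 0\<close>, both sides are \<open>0\<close> because division by
    zero yields \<open>0\<close>.\<close>
  have "x / (Q * (1 - x)) = 1 / (Q * (1 - x)) - 1 / Q" if "x \<noteq> 1" for Q x :: 'a
    using that by (cases "Q = 0") (auto simp: divide_simps)
  then have "a N / ((\<Prod>k<N. 1 - a k) * (1 - a N)) =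
      1 / ((\<Prod>k<N. 1 - a k) * (1 - a N)) - 1 / (\<Prod>k<N. 1 - a k)"
    using assms by blast
  with Suc.IH show ?case
    by (simp add: lessThan_Suc_atMost[symmetric])
qed simp

lemma sums_div_partial_prods:
  fixes a :: "nat \<Rightarrow> 'a::{real_normed_field}"
  assumes "\<And>k. a k \<noteq> 1" and "(\<lambda>N. \<Prod>k<N. 1 - a k) \<longlonglongrightarrow> P" and "P \<noteq> 0"
  shows "(\<lambda>k. a k / (\<Prod>j\<le>k. 1 - a j)) sums (1 / P - 1)"
  unfolding sums_def sum_div_partial_prods[OF assms(1)]
  using assms by (intro tendsto_intros)

text \<open>The reciprocal partial products converge, hence are bounded, so the terms are dominated
  by a multiple of \<open>norm (a k)\<close>. Absolute convergence is what later allows passing from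
  the ordered series to a sum over the set of primes.\<close>

lemma summable_norm_div_partial_prods:
  fixes a :: "nat \<Rightarrow> 'a::{real_normed_field}"
  assumes lim: "(\<lambda>N. \<Prod>k<N. 1 - a k) \<longlonglongrightarrow> P" and "P \<noteq> 0"
    and summable: "summable (\<lambda>k. norm (a k))"
  shows "summable (\<lambda>k. norm (a k / (\<Prod>j\<le>k. 1 - a j)))"
proof -
  have "(\<lambda>N. 1 / (\<Prod>k<Suc N. 1 - a k)) \<longlonglongrightarrow> 1 / P"
    using LIMSEQ_Suc[OF lim] \<open>P \<noteq> 0\<close> by (intro tendsto_intros)
  then have "Bseq (\<lambda>N. 1 / (\<Prod>k<Suc N. 1 - a k))"
    by (intro convergent_imp_Bseq) (auto simp: convergent_def)
  then obtain C where C: "\<And>k. norm (1 / (\<Prod>j\<le>k. 1 - a j)) \<le> C"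
    by (auto simp: Bseq_def lessThan_Suc_atMost)
  show ?thesis
  proof (rule summable_comparison_test')
    show "summable (\<lambda>k. norm (a k) * C)"
      by (intro summable_mult2 summable)
    show "norm (norm (a k / (\<Prod>j\<le>k. 1 - a j))) \<le> norm (a k) * C" for k
      using mult_left_mono[OF C[of k] norm_ge_zero[of "a k"]] by (simp add: norm_divide)
  qed
qed

section \<open>The Dirichlet series and its agreement with \<open>riemann_zeta\<close>\<close>

lemma norm_nat_powr: "norm (1 / of_nat n powr z :: complex) = real n powr - Re z"
  by (simp add: norm_divide norm_powr_real_powr powr_minus divide_simps)

lemma summable_norm_nat_powr:
  "Re z > 1 \<Longrightarrow> summable (\<lambda>n. norm (1 / of_nat n powr z :: complex))"
  unfolding norm_nat_powr by (simp add: summable_real_powr_iff)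

lemma dirichlet_series_holomorphic:
  "(\<lambda>z. \<Sum>n. 1 / of_nat (Suc n) powr z) holomorphic_on {z. Re z > 1}"
proof (rule holomorphic_uniform_sequence)
  show "open {z. Re z > 1}" by (rule open_halfspace_Re_gt)
  show "(\<lambda>z. \<Sum>n<N. 1 / of_nat (Suc n) powr z) holomorphic_on {z. Re z > 1}" for N
    by (intro holomorphic_intros) (auto simp del: of_nat_Suc)
  fix x :: complex assume "x \<in> {z. Re z > 1}"
  \<comment> \<open>Half the distance from \<open>x\<close> to the line \<open>Re z = 1\<close>: on
    the closed disc of radius \<open>d\<close> the series has the convergent majorant with exponent
    \<open>- (1 + d)\<close>.\<close>
  define d where "d = (Re x - 1) / 2"
  have d: "d > 0" using \<open>x \<in> _\<close> by (simp add: d_def)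
  have ge: "Re z \<ge> 1 + d" if "z \<in> cball x d" for z
    using that abs_Re_le_cmod[of "x - z"] by (simp add: dist_norm d_def field_simps)
  have "uniform_limit (cball x d) (\<lambda>N z. \<Sum>n<N. 1 / of_nat (Suc n) powr z)
      (\<lambda>z. \<Sum>n. 1 / of_nat (Suc n) powr z) sequentially"
  proof (rule Weierstrass_m_test)
    show "summable (\<lambda>n. real (Suc n) powr - (1 + d))"
      using d summable_Suc_iff[of "\<lambda>n. real n powr - (1 + d)"] by (simp add: summable_real_powr_iff)
    show "norm (1 / of_nat (Suc n) powr z :: complex) \<le> real (Suc n) powr - (1 + d)"
      if "z \<in> cball x d" for n z
      unfolding norm_nat_powr using ge[OF that] by (intro powr_mono) auto
  qed
  moreover have "cball x d \<subseteq> {z. Re z > 1}" using ge d by fastforce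
  ultimately show "\<exists>d>0. cball x d \<subseteq> {z. Re z > 1} \<and>
      uniform_limit (cball x d) (\<lambda>N z. \<Sum>n<N. 1 / of_nat (Suc n) powr z)
        (\<lambda>z. \<Sum>n. 1 / of_nat (Suc n) powr z) sequentially"
    using d by blast
qed

lemma dirichlet_series_sums:
  fixes z :: complex
  assumes "Re z > 1"
  shows "(\<lambda>n. 1 / of_nat (Suc n) powr z) sums (\<Sum>n. 1 / of_nat (Suc n) powr z)"
proof (rule summable_sums)
  have "summable (\<lambda>n. 1 / of_nat n powr z)"
    by (rule summable_norm_cancel[OF summable_norm_nat_powr[OF assms]])
  then show "summable (\<lambda>n. 1 / of_nat (Suc n) powr z)"
    by (subst summable_Suc_iff)
qed

text \<open>The half-plane itself serves as the domain \<open>U\<close>. Uniqueness holds because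
  \<open>s\<close> lies in the half-plane, where every candidate \<open>f\<close> equals the sum of
  the series.\<close>

lemma riemann_zeta_eq_suminf:
  assumes "Re s > 1"
  shows "riemann_zeta s = (\<Sum>n. 1 / of_nat (Suc n) powr s)"
  unfolding riemann_zeta_def
proof (rule the_equality)
  have "connected {z. Re z > 1}"
    by (intro convex_connected convex_halfspace_Re_gt)
  with assms show "\<exists>U f. open U \<and> connected U \<and> {z. Re z > 1} \<subseteq> U \<and> s \<in> U \<and>
     f holomorphic_on U \<and> (\<forall>z. Re z > 1 \<longrightarrow> (\<lambda>n. 1 / of_nat (Suc n) powr z) sums f z) \<and>
     f s = (\<Sum>n. 1 / of_nat (Suc n) powr s)"
    by (intro exI[of _ "{z. Re z > 1}"] exI[of _ "\<lambda>z. \<Sum>n. 1 / of_nat (Suc n) powr z"])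
      (simp add: open_halfspace_Re_gt dirichlet_series_holomorphic dirichlet_series_sums
        del: of_nat_Suc)
qed (use assms in \<open>blast intro: sums_unique\<close>)

text \<open>The convergence and non-vanishing clauses exclude default values such as
  \<open>1 / 0 = 0\<close>, so that the equations carry their usual meaning.\<close>

theorem corollary1p3:
  fixes s :: complex
  assumes "Re s > 1"
  shows "abs_convergent_prod (\<lambda>k. 1 - 1 / of_nat (nth_prime k) powr s) \<and>
         (\<Prod>k. 1 - 1 / of_nat (nth_prime k) powr s) \<noteq> 0 \<and>
         summable (\<lambda>n. 1 / of_nat (Suc n) powr s) \<and>
         1 / (\<Prod>k. 1 - 1 / of_nat (nth_prime k) powr s) = (\<Sum>n. 1 / of_nat (Suc n) powr s) \<and>
         (\<Sum>n. 1 / of_nat (Suc n) powr s) = riemann_zeta s \<and>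
         (\<lambda>p. 1 / (of_nat p powr s * (\<Prod>r\<in>{r::nat. prime r \<and> r \<le> p}. 1 - 1 / of_nat r powr s)))
           summable_on {p::nat. prime p} \<and>
         riemann_zeta s = 1 + (\<Sum>\<^sub>\<infinity>p\<in>{p::nat. prime p}.
           1 / (of_nat p powr s * (\<Prod>r\<in>{r::nat. prime r \<and> r \<le> p}. 1 - 1 / of_nat r powr s)))"
proof -
  \<comment> \<open>Here \<open>f 0 = 0\<close>, as \<open>0 powr s = 0\<close> and
    \<open>1 / 0 = 0\<close>; thus \<open>f\<close> is completely multiplicative on all of
    \<open>nat\<close>.\<close>
  define f :: "nat \<Rightarrow> complex" where "f n = 1 / of_nat n powr s" for n
  define a where "a k = f (nth_prime k)" for k
  define Z where "Z = (\<Sum>n. f (Suc n))"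
  define P where "P = (\<Prod>k. 1 - a k)"
  have f_summable: "summable (\<lambda>n. norm (f n))"
    unfolding f_def by (rule summable_norm_nat_powr[OF assms])
  have f_mult: "f (m * n) = f m * f n" for m n
    by (simp add: f_def powr_times_real)
  have a_summable: "summable (\<lambda>k. norm (a k))"
  proof -
    have "(\<lambda>n. norm (f n)) summable_on {p. prime p}"
      using summable_nonneg_imp_summable_on[OF f_summable] summable_on_subset_banach by auto
    then show ?thesis
      using summable_on_reindex_bij_betw[OF bij_betw_nth_prime, of "\<lambda>n. norm (f n)"]
      by (simp add: a_def summable_on_UNIV_nonneg_real_iff)
  qed
  have a_neq_1: "a k \<noteq> 1" for k
  proof -
    have "norm (a k) < 1"
      using prime_gt_1_nat[OF prime_nth_prime, of k] assms
        powr_less_mono[of "- Re s" 0 "real (nth_prime k)"]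
      unfolding a_def f_def norm_nat_powr by simp
    then show ?thesis by auto
  qed
  have abs: "abs_convergent_prod (\<lambda>k. 1 - a k)"
    by (rule summable_imp_abs_convergent_prod) (simp add: a_summable)
  then have "(\<lambda>N. \<Prod>k\<le>N. 1 - a k) \<longlonglongrightarrow> P"
    unfolding P_def by (intro convergent_prod_LIMSEQ abs_convergent_prod_imp_convergent_prod)
  then have P: "(\<lambda>N. \<Prod>k<N. 1 - a k) \<longlonglongrightarrow> P"
    unfolding lessThan_Suc_atMost[symmetric] by (rule LIMSEQ_imp_Suc)
  \<comment> \<open>The same sequence tends to \<open>1\<close> by the sieve and to
    \<open>P * Z\<close> by convergence of the product. Comparing the limits also shows
    \<open>P \<noteq> 0\<close>.\<close>
  have "(\<lambda>N. (\<Prod>k<N. 1 - a k) * Z) \<longlonglongrightarrow> 1"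
    unfolding a_def Z_def
    by (rule partial_euler_product_tendsto) (simp_all add: f_mult f_summable, simp add: f_def)
  with tendsto_mult_right[OF P, of Z] have PZ: "P * Z = 1"
    using LIMSEQ_unique by blast
  then have "P \<noteq> 0" by auto
  with PZ have inverse: "1 / P = Z" by (simp add: divide_eq_eq mult.commute)
  define t where
    "t p = 1 / (of_nat p powr s * (\<Prod>r\<in>{r::nat. prime r \<and> r \<le> p}. 1 - 1 / of_nat r powr s))" for p
  \<comment> \<open>The primes up to \<open>nth_prime k\<close> are those with indices
    \<open>0\<close> to \<open>k\<close>, so the inner product is a partial product over
    \<open>{..k}\<close>.\<close>
  have t: "t (nth_prime k) = a k / (\<Prod>j\<le>k. 1 - a j)" for k
  proof -
    have "inj_on nth_prime {..k}"
      by (rule strict_mono_imp_inj_on[OF strict_mono_nth_prime])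
    then show ?thesis
      by (simp add: t_def primes_le_nth_prime prod.reindex a_def f_def)
  qed
  \<comment> \<open>Absolute summability turns the telescoped series into an unordered sum, which is
    then carried over to the primes along the bijection \<open>nth_prime\<close>.\<close>
  have "((\<lambda>k. t (nth_prime k)) has_sum (Z - 1)) UNIV"
    unfolding t
    using norm_summable_imp_has_sum[OF summable_norm_div_partial_prods[OF P \<open>P \<noteq> 0\<close> a_summable]
        sums_div_partial_prods[OF a_neq_1 P \<open>P \<noteq> 0\<close>]]
    by (simp add: inverse)
  then have t_sum: "(t has_sum (Z - 1)) {p. prime p}"
    by (simp add: has_sum_reindex_bij_betw[OF bij_betw_nth_prime])
  have "summable (\<lambda>n. f (Suc n))"
    using dirichlet_series_sums[OF assms] unfolding f_def by (rule sums_summable)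
  moreover have "riemann_zeta s = Z"
    unfolding Z_def f_def by (rule riemann_zeta_eq_suminf[OF assms])
  moreover have "t summable_on {p. prime p}" "Z = 1 + infsum t {p. prime p}"
    using t_sum infsumI[OF t_sum] by (auto simp: summable_on_def)
  ultimately show ?thesis
    using abs \<open>P \<noteq> 0\<close> inverse
    unfolding P_def Z_def a_def f_def t_def by simp
qed

end
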